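(* For every integer $k\geq 3$, every constant degree bound $d$, every constant treewidth bound $t$ and every constant $\varepsilon\in(0,1)$, $k$-partiteness is strongly testable within the class of $k$-uniform $n$-vertex hypergraphs of maximum degree at most $d$ whose Gaifman graph has treewidth at most $t$: there is an $\varepsilon$-tester for $k$-partiteness, for inputs promised to lie in this class, whose query complexity does not depend on $n$.
   Context: A hypergraph is $k$-uniform if every hyperedge has exactly $k$ vertices; it is $k$-partite if there is a map $V(H)\to\{1,\dots,k\}$ giving the $k$ vertices of every hyperedge $k$ distinct colors. The Gaifman (primal) graph of $H$ has vertex set $V(H)$, two vertices adjacent iff they lie in a common hyperedge; the treewidth of $H$ is that of its Gaifman graph. Bounded degree model: a hypergraph of maximum degree at most $d$ is accessed via queries to lists $A_1,\dots,A_n$ of length $d$, $A_i$ listing the hyperedges incident to $i$ padded with $\bot$. Distance between $H_1=([n],E_1)$, $H_2=([n],E_2)$ is $(|E_1\setminus E_2|+|E_2\setminus E_1|)/(dn)$; $H$ is $\varepsilon$-far from a property if its distance to every $k$-uniform $n$-vertex hypergraph with the property exceeds $\varepsilon$. An $\varepsilon$-tester accepts with probability $\ge 2/3$ inputs with the property and with probability $\le 1/3$ inputs $\varepsilon$-far from it. Strongly testable means such a tester exists with query complexity independent of $n$. *)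

theory Defs
  imports "HOL-Probability.Probability_Mass_Function"
begin

section \<open>Treewidth\<close>

text \<open>A simple graph is given by a vertex set \<open>V\<close> and a set \<open>G\<close> of two-element subsets of \<open>V\<close>.\<close>

definition simple_graph :: "'a set \<Rightarrow> 'a set set \<Rightarrow> bool" where
  "simple_graph V G \<longleftrightarrow> (\<forall>f\<in>G. f \<subseteq> V \<and> card f = 2)"

text \<open>The subgraph induced by \<open>S\<close> is connected (vacuously so if \<open>S\<close> is empty).\<close>

definition connected_in :: "'a set set \<Rightarrow> 'a set \<Rightarrow> bool" where
  "connected_in G S \<longleftrightarrow>
     (\<forall>u\<in>S. \<forall>v\<in>S. (u, v) \<in> {(x, y). x \<in> S \<and> y \<in> S \<and> {x, y} \<in> G}\<^sup>*)"

definition is_cycle :: "'a set set \<Rightarrow> 'a list \<Rightarrow> bool" where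
  "is_cycle G xs \<longleftrightarrow>
     3 \<le> length xs \<and> distinct xs \<and>
     (\<forall>i. Suc i < length xs \<longrightarrow> {xs ! i, xs ! Suc i} \<in> G) \<and> {last xs, hd xs} \<in> G"

definition is_tree :: "'a set \<Rightarrow> 'a set set \<Rightarrow> bool" where
  "is_tree I F \<longleftrightarrow>
     finite I \<and> I \<noteq> {} \<and> simple_graph I F \<and> connected_in F I \<and> (\<nexists>xs. is_cycle F xs)"

text \<open>Tree nodes are natural numbers, which is no restriction because the trees are finite.\<close>

definition tree_decomposition ::
    "'a set \<Rightarrow> 'a set set \<Rightarrow> nat set \<Rightarrow> nat set set \<Rightarrow> (nat \<Rightarrow> 'a set) \<Rightarrow> bool" where
  "tree_decomposition V G I F B \<longleftrightarrow>
     is_tree I F \<and>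
     (\<Union>i\<in>I. B i) = V \<and>
     (\<forall>f\<in>G. \<exists>i\<in>I. f \<subseteq> B i) \<and>
     (\<forall>v\<in>V. connected_in F {i \<in> I. v \<in> B i})"

text \<open>Subtraction on \<open>nat\<close> truncates, so the graph without vertices gets treewidth 0 rather than
  -1; this does not affect any bound \<open>treewidth V G \<le> t\<close> with \<open>t :: nat\<close>. The set below is nonempty
  for finite \<open>V\<close>, see \<open>treewidth_le_iff\<close>.\<close>

definition decomposition_width :: "nat set \<Rightarrow> (nat \<Rightarrow> 'a set) \<Rightarrow> nat" where
  "decomposition_width I B = Max ((\<lambda>i. card (B i)) ` I) - 1"

definition treewidth :: "'a set \<Rightarrow> 'a set set \<Rightarrow> nat" where
  "treewidth V G = Inf {decomposition_width I B | I F B. tree_decomposition V G I F B}"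

lemma trivial_tree_decomposition:
  assumes "simple_graph V G"
  shows "tree_decomposition V G {0} {} (\<lambda>_. V)"
  using assms
  by (auto simp: tree_decomposition_def is_tree_def simple_graph_def connected_in_def is_cycle_def)

lemma treewidth_le_iff:
  assumes "simple_graph V G"
  shows "treewidth V G \<le> t \<longleftrightarrow>
    (\<exists>I F B. tree_decomposition V G I F B \<and> decomposition_width I B \<le> t)"
proof -
  let ?W = "{decomposition_width I B | I F B. tree_decomposition V G I F B}"
  have ne: "?W \<noteq> {}"
    using trivial_tree_decomposition[OF assms] by blast
  show ?thesis
  proof
    assume "treewidth V G \<le> t"
    moreover have "Inf ?W \<in> ?W"
      using ne by (rule Inf_nat_def1)
    ultimately show "\<exists>I F B. tree_decomposition V G I F B \<and> decomposition_width I B \<le> t"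
      unfolding treewidth_def by (smt (verit) mem_Collect_eq)
  next
    assume "\<exists>I F B. tree_decomposition V G I F B \<and> decomposition_width I B \<le> t"
    then obtain w where "w \<in> ?W" "w \<le> t"
      by blast
    then show "treewidth V G \<le> t"
      unfolding treewidth_def by (meson cInf_lower bdd_below_bot order_trans)
  qed
qed

section \<open>Hypergraphs on the vertex set \<open>{1..n}\<close>\<close>

definition uniform_hypergraph :: "nat \<Rightarrow> nat \<Rightarrow> nat set set \<Rightarrow> bool" where
  "uniform_hypergraph k n E \<longleftrightarrow> (\<forall>e\<in>E. e \<subseteq> {1..n} \<and> card e = k)"

definition incident_edges :: "nat set set \<Rightarrow> nat \<Rightarrow> nat set set" where
  "incident_edges E v = {e \<in> E. v \<in> e}"

definition max_degree_le :: "nat \<Rightarrow> nat \<Rightarrow> nat set set \<Rightarrow> bool" where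
  "max_degree_le d n E \<longleftrightarrow> (\<forall>v\<in>{1..n}. card (incident_edges E v) \<le> d)"

definition k_partite :: "nat \<Rightarrow> nat \<Rightarrow> nat set set \<Rightarrow> bool" where
  "k_partite k n E \<longleftrightarrow> (\<exists>c. c ` {1..n} \<subseteq> {1..k} \<and> (\<forall>e\<in>E. inj_on c e))"

definition gaifman_edges :: "nat set set \<Rightarrow> nat set set" where
  "gaifman_edges E = {{u, v} | u v e. e \<in> E \<and> u \<in> e \<and> v \<in> e \<and> u \<noteq> v}"

lemma simple_graph_gaifman:
  assumes "uniform_hypergraph k n E"
  shows "simple_graph {1..n} (gaifman_edges E)"
  unfolding simple_graph_def
proof
  fix f assume "f \<in> gaifman_edges E"
  then obtain u v e where "f = {u, v}" "e \<in> E" "u \<in> e" "v \<in> e" "u \<noteq> v"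
    unfolding gaifman_edges_def by blast
  moreover from this have "e \<subseteq> {1..n}"
    using assms unfolding uniform_hypergraph_def by blast
  ultimately show "f \<subseteq> {1..n} \<and> card f = 2"
    by auto
qed

definition hypergraph_treewidth :: "nat \<Rightarrow> nat set set \<Rightarrow> nat" where
  "hypergraph_treewidth n E = treewidth {1..n} (gaifman_edges E)"

definition bounded_treewidth_class :: "nat \<Rightarrow> nat \<Rightarrow> nat \<Rightarrow> nat \<Rightarrow> nat set set set" where
  "bounded_treewidth_class k d t n =
     {E. uniform_hypergraph k n E \<and> max_degree_le d n E \<and> hypergraph_treewidth n E \<le> t}"

section \<open>Bounded degree model\<close>

text \<open>If \<open>d = 0\<close> or \<open>n = 0\<close>, division by zero yields distance 0. A \<open>k\<close>-uniform hypergraph of maximum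
  degree at most \<open>d\<close> then has no hyperedges (for \<open>k > 0\<close>).\<close>

definition hypergraph_dist :: "nat \<Rightarrow> nat \<Rightarrow> nat set set \<Rightarrow> nat set set \<Rightarrow> real" where
  "hypergraph_dist d n E\<^sub>1 E\<^sub>2 =
     (real (card (E\<^sub>1 - E\<^sub>2)) + real (card (E\<^sub>2 - E\<^sub>1))) / (real d * real n)"

definition far_from ::
    "real \<Rightarrow> nat \<Rightarrow> nat \<Rightarrow> nat \<Rightarrow> (nat set set \<Rightarrow> bool) \<Rightarrow> nat set set \<Rightarrow> bool" where
  "far_from \<epsilon> k d n P E \<longleftrightarrow>
     (\<forall>E'. uniform_hypergraph k n E' \<and> P E' \<longrightarrow> hypergraph_dist d n E E' > \<epsilon>)"

text \<open>\<open>A i j\<close> with \<open>j < d\<close> is entry \<open>j\<close> of the list for vertex \<open>i\<close>, and \<open>None\<close> is the padding symbol.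
  The order of the hyperedges in each list is arbitrary. Entries with \<open>i \<notin> {1..n}\<close> or \<open>j \<ge> d\<close> are
  meaningless; \<open>query_bounded\<close> forbids algorithms to ask for them.\<close>

type_synonym incidence_lists = "nat \<Rightarrow> nat \<Rightarrow> nat set option"

definition represents :: "nat \<Rightarrow> nat \<Rightarrow> incidence_lists \<Rightarrow> nat set set \<Rightarrow> bool" where
  "represents d n A E \<longleftrightarrow>
     (\<forall>i\<in>{1..n}. \<exists>es. distinct es \<and> set es = incident_edges E i \<and>
        map (A i) [0..<d] = map Some es @ replicate (d - length es) None)"

text \<open>Deterministic adaptive query algorithms as decision trees. A randomized algorithm is a
  probability distribution on deterministic ones.\<close>

datatype query_algorithm =
    Output bool
  | Query nat nat "nat set option \<Rightarrow> query_algorithm"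

primrec accepts :: "incidence_lists \<Rightarrow> query_algorithm \<Rightarrow> bool" where
  "accepts A (Output b) = b"
| "accepts A (Query i j f) = accepts A (f (A i j))"

primrec queries :: "incidence_lists \<Rightarrow> query_algorithm \<Rightarrow> (nat \<times> nat) list" where
  "queries A (Output b) = []"
| "queries A (Query i j f) = (i, j) # queries A (f (A i j))"

definition query_bounded :: "nat \<Rightarrow> nat \<Rightarrow> nat \<Rightarrow> query_algorithm pmf \<Rightarrow> bool" where
  "query_bounded d n q M \<longleftrightarrow>
     (\<forall>T\<in>set_pmf M. \<forall>A. set (queries A T) \<subseteq> {1..n} \<times> {..<d} \<and> length (queries A T) \<le> q)"

definition accept_prob :: "query_algorithm pmf \<Rightarrow> incidence_lists \<Rightarrow> real" where
  "accept_prob M A = measure_pmf.prob M {T. accepts A T}"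

definition is_tester ::
    "real \<Rightarrow> nat \<Rightarrow> nat \<Rightarrow> nat \<Rightarrow> nat set set set \<Rightarrow> (nat set set \<Rightarrow> bool)
      \<Rightarrow> query_algorithm pmf \<Rightarrow> bool" where
  "is_tester \<epsilon> k d n C P M \<longleftrightarrow>
     (\<forall>E\<in>C. \<forall>A. represents d n A E \<longrightarrow>
        (P E \<longrightarrow> accept_prob M A \<ge> 2 / 3) \<and>
        (far_from \<epsilon> k d n P E \<longrightarrow> accept_prob M A \<le> 1 / 3))"

text \<open>The tester \<open>M n\<close> may depend on \<open>n\<close>, but the bound \<open>q\<close> on its number of queries may not.\<close>

definition strongly_testable ::
    "nat \<Rightarrow> nat \<Rightarrow> (nat \<Rightarrow> nat set set set) \<Rightarrow> (nat \<Rightarrow> nat set set \<Rightarrow> bool) \<Rightarrow> bool" where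
  "strongly_testable k d C P \<longleftrightarrow>
     (\<forall>\<epsilon>. 0 < \<epsilon> \<and> \<epsilon> < 1 \<longrightarrow>
        (\<exists>q M. \<forall>n. is_tester \<epsilon> k d n (C n) (P n) (M n) \<and> query_bounded d n q (M n)))"

end

theory Submission
  imports Defs
begin

text \<open>The tester samples constantly many vertices, explores the balls of constant radius around them
  and accepts iff the hyperedges seen form a \<open>k\<close>-partite hypergraph; it never rejects a \<open>k\<close>-partite
  input. Conversely, cutting the tree decomposition at bags yields a set \<open>X\<close> of at most
  \<open>(t + 1) n / s\<close> vertices whose removal leaves pieces of at most \<open>s\<close> vertices. With
  \<open>s \<ge> 2 (t + 1) / \<epsilon>\<close>, deleting the hyperedges at \<open>X\<close> and at the components which are not
  \<open>k\<close>-partite makes the input \<open>k\<close>-partite. If the input is \<open>\<epsilon>\<close>-far, at least \<open>\<epsilon> n / 2\<close> vertices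
  thus lie in such components, and sampling any of them makes the tester reject.\<close>

section \<open>Leaf orderings of trees\<close>

text \<open>The edge \<open>{l, j}\<close> itself is not demanded: \<open>j\<close> is the only
  possible neighbour of the new leaf \<open>l\<close> in \<open>I\<close>, and an arbitrary element
  of \<open>I\<close> if \<open>l\<close> has none. So nonempty finite forests are covered as
  well.\<close>

inductive leaf_ordered :: "'a set set \<Rightarrow> 'a set \<Rightarrow> bool" for F where
  single: "leaf_ordered F {i}"
| leaf: "\<lbrakk>leaf_ordered F I; l \<notin> I; j \<in> I; \<And>i. \<lbrakk>i \<in> I; {l, i} \<in> F\<rbrakk> \<Longrightarrow> i = j\<rbrakk>
    \<Longrightarrow> leaf_ordered F (insert l I)"

definition path_in :: "'a set set \<Rightarrow> 'a set \<Rightarrow> 'a list \<Rightarrow> bool" where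
  "path_in F I xs \<longleftrightarrow> distinct xs \<and> set xs \<subseteq> I \<and>
     (\<forall>i. Suc i < length xs \<longrightarrow> {xs ! i, xs ! Suc i} \<in> F)"

lemma path_in_Cons:
  assumes "path_in F I (x # xs)" "y \<in> I" "y \<notin> set (x # xs)" "{x, y} \<in> F"
  shows "path_in F I (y # x # xs)"
  unfolding path_in_def
proof (intro conjI allI impI)
  fix i assume i: "Suc i < length (y # x # xs)"
  show "{(y # x # xs) ! i, (y # x # xs) ! Suc i} \<in> F"
  proof (cases i)
    case 0
    then show ?thesis using assms(4) by (simp add: insert_commute)
  next
    case (Suc m)
    then show ?thesis using assms(1) i unfolding path_in_def by simp
  qed
qed (use assms in \<open>auto simp: path_in_def\<close>)

text \<open>The first vertex of a longest path is a leaf: a second neighbour would extend the path or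
  close a cycle.\<close>

lemma acyclic_has_leaf:
  assumes "finite I" "a \<in> I" "b \<in> I" "a \<noteq> b"
    and edges: "\<And>f. f \<in> F \<Longrightarrow> card f = 2" and acyclic: "\<nexists>xs. is_cycle F xs"
  obtains l j where "l \<in> I" "j \<in> I" "j \<noteq> l" "\<And>i. \<lbrakk>i \<in> I; {l, i} \<in> F\<rbrakk> \<Longrightarrow> i = j"
proof -
  have "path_in F I [a]"
    using assms(2) by (simp add: path_in_def)
  moreover have "\<forall>ys. path_in F I ys \<longrightarrow> length ys < Suc (card I)"
    using assms(1) by (auto simp: path_in_def less_Suc_eq_le simp flip: distinct_card intro: card_mono)
  ultimately have "\<exists>xs. path_in F I xs \<and> (\<forall>ys. path_in F I ys \<longrightarrow> length ys \<le> length xs)"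
    by (rule Lattices_Big.ex_has_greatest_nat)
  then obtain xs
    where xs: "path_in F I xs" "\<And>ys. path_in F I ys \<Longrightarrow> length ys \<le> length xs"
    by blast
  have "xs \<noteq> []"
    using xs(2)[OF \<open>path_in F I [a]\<close>] by auto
  then obtain l ys where l: "xs = l # ys"
    by (cases xs) auto
  have "l \<in> I"
    using xs(1) l by (simp add: path_in_def)
  have nbr: "i = xs ! 1 \<and> 1 < length xs" if i: "i \<in> I" "{l, i} \<in> F" for i
  proof -
    have "i \<noteq> l"
      using edges[OF i(2)] by auto
    have "i \<in> set xs"
    proof (rule ccontr)
      assume "i \<notin> set xs"
      then have "path_in F I (i # xs)"
        using path_in_Cons[of F I l ys i] xs(1) i unfolding l by blast
      then show False
        using xs(2) by fastforce
    qed
    then obtain m where m: "m < length xs" "xs ! m = i"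
      by (metis in_set_conv_nth)
    have "m \<noteq> 0"
      using m \<open>i \<noteq> l\<close> l by (cases m) auto
    have "is_cycle F (take (Suc m) xs)" if "2 \<le> m"
      unfolding is_cycle_def
    proof (intro conjI allI impI)
      have "last (take (Suc m) xs) = i"
        using m by (simp add: take_Suc_conv_app_nth)
      moreover have "hd (take (Suc m) xs) = l"
        using l by simp
      ultimately show "{last (take (Suc m) xs), hd (take (Suc m) xs)} \<in> F"
        using i by (simp add: insert_commute)
    qed (use m that xs(1) in \<open>auto simp: path_in_def\<close>)
    then have "\<not> 2 \<le> m"
      using acyclic by blast
    then have "m = 1"
      using \<open>m \<noteq> 0\<close> by linarith
    then show ?thesis using m by auto
  qed
  show thesis
  proof (cases "1 < length xs")
    case True
    have "xs ! 1 \<in> I" "xs ! 1 \<noteq> xs ! 0"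
      using xs(1) True nth_eq_iff_index_eq[of xs 1 0] nth_mem[of 1 xs] \<open>xs \<noteq> []\<close>
      unfolding path_in_def by auto
    then show thesis
      using that[of l "xs ! 1"] nbr \<open>l \<in> I\<close> l by auto
  next
    \<comment> \<open>Here \<open>l\<close> has no neighbour at all, so any other vertex can serve
      as \<open>j\<close>.\<close>
    case False
    obtain j where "j \<in> I" "j \<noteq> l"
      using assms(2-4) by (cases "a = l") auto
    then show thesis
      using that[of l j] nbr \<open>l \<in> I\<close> False by blast
  qed
qed

lemma acyclic_leaf_ordered:
  assumes "finite I" "I \<noteq> {}" "\<And>f. f \<in> F \<Longrightarrow> card f = 2" "\<nexists>xs. is_cycle F xs"
  shows "leaf_ordered F I"
  using assms(1,2)
proof (induction I rule: finite_psubset_induct)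
  case (psubset I)
  obtain a where a: "a \<in> I"
    using psubset.prems by blast
  show ?case
  proof (cases "I = {a}")
    case True
    then show ?thesis by (simp add: leaf_ordered.single)
  next
    case False
    then obtain b where b: "b \<in> I" "a \<noteq> b"
      using a by blast
    obtain l j where lj: "l \<in> I" "j \<in> I" "j \<noteq> l" "\<And>i. \<lbrakk>i \<in> I; {l, i} \<in> F\<rbrakk> \<Longrightarrow> i = j"
      using acyclic_has_leaf[OF psubset.hyps(1) a b assms(3,4)] by blast
    have "leaf_ordered F (I - {l})"
      using psubset.IH[of "I - {l}"] lj by blast
    then have "leaf_ordered F (insert l (I - {l}))"
      using lj by (intro leaf_ordered.leaf[of _ _ _ j]) auto
    then show ?thesis
      using lj(1) by (simp add: insert_absorb)
  qed
qed

section \<open>Connected index sets under removal of a leaf\<close>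

text \<open>A walk that visits \<open>l\<close> must enter and leave it through \<open>j\<close>, so
  the detour can be cut out.\<close>

lemma connected_in_remove_leaf:
  assumes conn: "connected_in F S" and nbr: "\<And>i. \<lbrakk>i \<in> S - {l}; {l, i} \<in> F\<rbrakk> \<Longrightarrow> i = j"
  shows "connected_in F (S - {l})"
  unfolding connected_in_def
proof (intro ballI)
  let ?R = "\<lambda>S. {(x, y). x \<in> S \<and> y \<in> S \<and> {x, y} \<in> F}"
  fix u v assume uv: "u \<in> S - {l}" "v \<in> S - {l}"
  have "(u, v) \<in> (?R S)\<^sup>*"
    using conn uv unfolding connected_in_def by blast
  \<comment> \<open>While the walk stands at \<open>l\<close>, the induction remembers
    \<open>j\<close>, the vertex from which \<open>l\<close> was entered.\<close>
  then have "(v \<noteq> l \<longrightarrow> (u, v) \<in> (?R (S - {l}))\<^sup>*) \<and> (v = l \<longrightarrow> (u, j) \<in> (?R (S - {l}))\<^sup>*)"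
  proof (induction rule: rtrancl_induct)
    case base
    then show ?case using uv by auto
  next
    case (step w z)
    have wz: "w \<in> S" "z \<in> S" "{w, z} \<in> F"
      using step.hyps by auto
    consider "w = l" "z = l" | "w = l" "z \<noteq> l" | "w \<noteq> l" "z = l" | "w \<noteq> l" "z \<noteq> l"
      by blast
    then show ?case
    proof cases
      case 2
      then show ?thesis using step.IH nbr[of z] wz by auto
    next
      case 3
      then show ?thesis using step.IH nbr[of w] wz by (auto simp: insert_commute)
    next
      case 4
      then have "(w, z) \<in> ?R (S - {l})" using wz by auto
      then show ?thesis using 4 step.IH by (meson rtrancl.rtrancl_into_rtrancl)
    qed (use step.IH in auto)
  qed
  then show "(u, v) \<in> (?R (S - {l}))\<^sup>*"
    using uv by auto
qed

lemma connected_in_neighbour: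
  assumes "connected_in F S" "l \<in> S" "i \<in> S" "i \<noteq> l"
  obtains m where "m \<in> S - {l}" "{l, m} \<in> F"
proof -
  have "(l, i) \<in> {(x, y). x \<in> S \<and> y \<in> S \<and> {x, y} \<in> F}\<^sup>*"
    using assms unfolding connected_in_def by blast
  then have "i \<noteq> l \<longrightarrow> (\<exists>m\<in>S - {l}. {l, m} \<in> F)"
    by (induction rule: rtrancl_induct) auto
  then show thesis
    using assms(4) that by blast
qed

section \<open>Hyperfiniteness of graphs of bounded treewidth\<close>

text \<open>A piece is closed under the edges inside \<open>W\<close> but need not be connected.
  Hence any set \<open>W\<close> of at most \<open>s\<close> vertices is a single piece, and pieces
  survive restriction to a smaller set.\<close>

definition separated_piece :: "'a set set \<Rightarrow> nat \<Rightarrow> 'a set \<Rightarrow> 'a set \<Rightarrow> bool" where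
  "separated_piece G s W p \<longleftrightarrow> p \<subseteq> W \<and> finite p \<and> card p \<le> s \<and>
     (\<forall>f\<in>G. f \<subseteq> W \<and> f \<inter> p \<noteq> {} \<longrightarrow> f \<subseteq> p)"

definition small_pieces :: "'a set set \<Rightarrow> nat \<Rightarrow> 'a set \<Rightarrow> bool" where
  "small_pieces G s W \<longleftrightarrow> (\<forall>v\<in>W. \<exists>p. v \<in> p \<and> separated_piece G s W p)"

lemma small_pieces_card_le:
  assumes "finite W" "card W \<le> s"
  shows "small_pieces G s W"
proof -
  have "separated_piece G s W W"
    using assms by (simp add: separated_piece_def)
  then show ?thesis
    unfolding small_pieces_def by blast
qed

lemma small_pieces_mono:
  assumes "small_pieces G s W" "W' \<subseteq> W"
  shows "small_pieces G s W'"
proof -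
  have "separated_piece G s W' (p \<inter> W')" if p: "separated_piece G s W p" for p
    unfolding separated_piece_def
  proof (intro conjI ballI impI)
    show "card (p \<inter> W') \<le> s"
      using p card_mono[of p "p \<inter> W'"] unfolding separated_piece_def by simp
    show "f \<subseteq> p \<inter> W'" if "f \<in> G" "f \<subseteq> W' \<and> f \<inter> (p \<inter> W') \<noteq> {}" for f
    proof -
      have "f \<subseteq> W" "f \<inter> p \<noteq> {}"
        using that assms(2) by blast+
      then have "f \<subseteq> p"
        using p that(1) unfolding separated_piece_def by simp
      then show ?thesis
        using that(2) by blast
    qed
  qed (use p in \<open>auto simp: separated_piece_def\<close>)
  then show ?thesis
    using assms unfolding small_pieces_def by (meson IntI subsetD)
qed

lemma small_pieces_Un:
  assumes "small_pieces G s W\<^sub>1" "small_pieces G s W\<^sub>2" "W\<^sub>1 \<inter> W\<^sub>2 = {}"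
    and sep: "\<And>f. \<lbrakk>f \<in> G; f \<subseteq> W\<^sub>1 \<union> W\<^sub>2\<rbrakk> \<Longrightarrow> f \<subseteq> W\<^sub>1 \<or> f \<subseteq> W\<^sub>2"
  shows "small_pieces G s (W\<^sub>1 \<union> W\<^sub>2)"
proof -
  have piece: "separated_piece G s (W\<^sub>1 \<union> W\<^sub>2) p"
    if p: "separated_piece G s W p" and W: "W = W\<^sub>1 \<and> W' = W\<^sub>2 \<or> W = W\<^sub>2 \<and> W' = W\<^sub>1" for p W W'
    unfolding separated_piece_def
  proof (intro conjI ballI impI)
    fix f assume f: "f \<in> G" "f \<subseteq> W\<^sub>1 \<union> W\<^sub>2 \<and> f \<inter> p \<noteq> {}"
    have "p \<subseteq> W" "W \<inter> W' = {}" "f \<subseteq> W \<or> f \<subseteq> W'"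
      using p W assms(3) sep[of f] f unfolding separated_piece_def by auto
    then have "f \<subseteq> W"
      using f(2) by blast
    then show "f \<subseteq> p"
      using p f unfolding separated_piece_def by simp
  qed (use p W in \<open>auto simp: separated_piece_def\<close>)
  show ?thesis
    unfolding small_pieces_def
  proof
    fix v assume "v \<in> W\<^sub>1 \<union> W\<^sub>2"
    then consider "v \<in> W\<^sub>1" | "v \<in> W\<^sub>2" by blast
    then show "\<exists>p. v \<in> p \<and> separated_piece G s (W\<^sub>1 \<union> W\<^sub>2) p"
    proof cases
      case 1
      then obtain p where "v \<in> p" "separated_piece G s W\<^sub>1 p"
        using assms(1) unfolding small_pieces_def by blast
      then show ?thesis using piece[of W\<^sub>1 p W\<^sub>2] by auto
    next
      case 2
      then obtain p where "v \<in> p" "separated_piece G s W\<^sub>2 p"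
        using assms(2) unfolding small_pieces_def by blast
      then show ?thesis using piece[of W\<^sub>2 p W\<^sub>1] by auto
    qed
  qed
qed

text \<open>The vertices of \<open>C i - B i\<close> occur in no other bag and are already cut into small pieces by
  \<open>B i\<close>. A leaf \<open>l\<close> with neighbour \<open>j\<close> is merged into \<open>j\<close> if it contributes at most \<open>s\<close> vertices;
  otherwise \<open>B l\<close> is put into the separator, which is paid for by the vertices of \<open>C l\<close>.\<close>

lemma tree_separator:
  assumes "leaf_ordered F I"
    and "\<And>i. i \<in> I \<Longrightarrow> finite (C i)"
    and "\<And>i. i \<in> I \<Longrightarrow> B i \<subseteq> C i"
    and "\<And>i. i \<in> I \<Longrightarrow> card (B i) \<le> b"
    and "\<And>i i'. \<lbrakk>i \<in> I; i' \<in> I; i \<noteq> i'\<rbrakk> \<Longrightarrow> C i \<inter> C i' \<subseteq> B i"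
    and "\<And>i. i \<in> I \<Longrightarrow> small_pieces G s (C i - B i)"
    and "\<And>f. \<lbrakk>f \<in> G; f \<subseteq> \<Union>(C ` I)\<rbrakk> \<Longrightarrow> \<exists>i\<in>I. f \<subseteq> C i"
    and "\<And>v. connected_in F {i \<in> I. v \<in> C i}"
  shows "\<exists>X\<subseteq>\<Union>(C ` I). card X * s \<le> b * card (\<Union>(C ` I)) \<and> small_pieces G s (\<Union>(C ` I) - X)"
  using assms
proof (induction arbitrary: C B rule: leaf_ordered.induct)
  case (single i)
  show ?case
  proof (cases "card (C i) \<le> s")
    case True
    then have "small_pieces G s (C i)"
      using single(1) by (simp add: small_pieces_card_le)
    then show ?thesis by (intro exI[of _ "{}"]) simp
  next
    \<comment> \<open>More than \<open>s\<close> vertices in \<open>C i\<close> pay for the at most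
      \<open>b\<close> vertices of \<open>B i\<close>.\<close>
    case False
    then have "card (B i) * s \<le> b * card (C i)"
      using single(3)[of i] by (intro mult_le_mono) auto
    then show ?thesis
      using single(2)[of i] single(5)[of i] by (intro exI[of _ "B i"]) simp
  qed
next
  case (leaf I l j)
  note fin = leaf.prems(1) and BC = leaf.prems(2) and Bb = leaf.prems(3) and meet = leaf.prems(4)
    and pieces = leaf.prems(5) and cover = leaf.prems(6) and conn = leaf.prems(7)
  have "finite I"
    using leaf.hyps(1) by (induction rule: leaf_ordered.induct) auto
  have jl: "j \<noteq> l"
    using leaf.hyps by blast
  \<comment> \<open>The indices of the bags containing \<open>v\<close> are connected, so
    \<open>l\<close> has a neighbour among them, which can only be \<open>j\<close>.\<close>
  have via_j: "v \<in> C j" if v: "v \<in> C l" "i \<in> I" "v \<in> C i" for v i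
  proof -
    have "l \<in> {i \<in> insert l I. v \<in> C i}" "i \<in> {i \<in> insert l I. v \<in> C i}" "i \<noteq> l"
      using v leaf.hyps(2) by auto
    then obtain m where "m \<in> {i \<in> insert l I. v \<in> C i} - {l}" "{l, m} \<in> F"
      by (rule connected_in_neighbour[OF conn])
    then show ?thesis
      using leaf.hyps(4)[of m] by auto
  qed
  have conn_I: "connected_in F {i \<in> I. v \<in> C i}" for v
  proof -
    have "connected_in F ({i \<in> insert l I. v \<in> C i} - {l})"
      using leaf.hyps(4) by (intro connected_in_remove_leaf[OF conn, of _ _ j]) blast
    moreover have "{i \<in> insert l I. v \<in> C i} - {l} = {i \<in> I. v \<in> C i}"
      using leaf.hyps(2) by blast
    ultimately show ?thesis by simp
  qed
  show ?case
  proof (cases "card (C l - B j) \<le> s")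
    case True
    define C' where "C' = C(j := C j \<union> C l)"
    have U: "\<Union>(C' ` I) = \<Union>(C ` insert l I)"
      using leaf.hyps(3) by (auto simp: C'_def split: if_splits)
    have "\<exists>X\<subseteq>\<Union>(C' ` I). card X * s \<le> b * card (\<Union>(C' ` I)) \<and>
        small_pieces G s (\<Union>(C' ` I) - X)"
    proof (rule leaf.IH[of C' B])
      show "finite (C' i)" if "i \<in> I" for i
        using fin that by (auto simp: C'_def)
      show "B i \<subseteq> C' i" if "i \<in> I" for i
        using BC that by (auto simp: C'_def)
      show "card (B i) \<le> b" if "i \<in> I" for i
        using Bb that by simp
      show "C' i \<inter> C' i' \<subseteq> B i" if "i \<in> I" "i' \<in> I" "i \<noteq> i'" for i i'
      proof
        fix v assume v: "v \<in> C' i \<inter> C' i'"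
        \<comment> \<open>Merging creates no new overlaps: a vertex that \<open>C l\<close> shares
          with a bag of \<open>I\<close> was in \<open>C j\<close> before.\<close>
        have "v \<in> C i \<inter> C i'"
          using v via_j that leaf.hyps(3) by (auto simp: C'_def split: if_splits)
        then show "v \<in> B i" using meet[of i i'] that by blast
      qed
      show "small_pieces G s (C' i - B i)" if "i \<in> I" for i
      proof (cases "i = j")
        case True
        have "small_pieces G s ((C j - B j) \<union> (C l - B j))"
        proof (rule small_pieces_Un)
          show "small_pieces G s (C j - B j)"
            using pieces leaf.hyps(3) by blast
          show "small_pieces G s (C l - B j)"
            using \<open>card (C l - B j) \<le> s\<close> fin by (simp add: small_pieces_card_le)
          show "(C j - B j) \<inter> (C l - B j) = {}"
            using meet[of j l] leaf.hyps(3) jl by blast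
          fix f assume f: "f \<in> G" "f \<subseteq> (C j - B j) \<union> (C l - B j)"
          then have "f \<subseteq> \<Union>(C ` insert l I)"
            using leaf.hyps(3) by blast
          then obtain i where i: "i \<in> insert l I" "f \<subseteq> C i"
            using cover f(1) by blast
          \<comment> \<open>A bag other than \<open>C j\<close> meets \<open>C j\<close> only inside
            \<open>B j\<close>, so an edge in such a bag avoids \<open>C j - B j\<close>.\<close>
          show "f \<subseteq> C j - B j \<or> f \<subseteq> C l - B j"
          proof (cases "i = j")
            case True
            then show ?thesis using i f by blast
          next
            case False
            then have "C j \<inter> C i \<subseteq> B j"
              using meet[of j i] i leaf.hyps(3) by blast
            then show ?thesis using i f by blast
          qed
        qed
        moreover have "C' i - B i = (C j - B j) \<union> (C l - B j)"
          using True by (auto simp: C'_def)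
        ultimately show ?thesis by simp
      next
        case False
        then show ?thesis using pieces that by (simp add: C'_def)
      qed
      show "\<exists>i\<in>I. f \<subseteq> C' i" if f: "f \<in> G" "f \<subseteq> \<Union>(C' ` I)" for f
      proof -
        obtain i where "i \<in> insert l I" "f \<subseteq> C i"
          using cover[OF f(1) f(2)[unfolded U]] by blast
        then show ?thesis
          using leaf.hyps(3) by (cases "i = l") (auto simp: C'_def intro: bexI[of _ i] bexI[of _ j])
      qed
      show "connected_in F {i \<in> I. v \<in> C' i}" for v
      \<comment> \<open>If \<open>v\<close> is in \<open>C l\<close>, either no bag of
        \<open>I\<close> contained it and \<open>j\<close> is now its only index, or
        \<open>via_j\<close> shows that \<open>j\<close> was an index already.\<close>
      proof (cases "v \<in> C l")
        case True
        have eq: "{i \<in> I. v \<in> C' i} = insert j {i \<in> I. v \<in> C i}"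
          using True leaf.hyps(3) by (auto simp: C'_def)
        show ?thesis
        proof (cases "{i \<in> I. v \<in> C i} = {}")
          case True
          show ?thesis unfolding eq True by (simp add: connected_in_def)
        next
          case False
          then have "v \<in> C j"
            using via_j \<open>v \<in> C l\<close> by blast
          then have "insert j {i \<in> I. v \<in> C i} = {i \<in> I. v \<in> C i}"
            using leaf.hyps(3) by blast
          then show ?thesis using eq conn_I by simp
        qed
      next
        case False
        then have "{i \<in> I. v \<in> C' i} = {i \<in> I. v \<in> C i}"
          by (auto simp: C'_def)
        then show ?thesis using conn_I by simp
      qed
    qed
    then show ?thesis unfolding U .
  next
    case False
    have "s \<le> card (C l)"
      using False card_mono[of "C l" "C l - B j"] fin by fastforce
    \<comment> \<open>All of \<open>C l\<close> leaves the instance, although only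
      \<open>B l\<close> joins the separator: \<open>C l - B l\<close> meets no other bag and
      already splits into small pieces.\<close>
    define C' where "C' = (\<lambda>i. C i - C l)"
    have U: "\<Union>(C' ` I) = \<Union>(C ` insert l I) - C l"
      by (auto simp: C'_def)
    have "\<exists>X\<subseteq>\<Union>(C' ` I). card X * s \<le> b * card (\<Union>(C' ` I)) \<and>
        small_pieces G s (\<Union>(C' ` I) - X)"
    proof (rule leaf.IH[of C' "\<lambda>i. B i - C l"])
      show "finite (C' i)" if "i \<in> I" for i
        using fin that by (auto simp: C'_def)
      show "B i - C l \<subseteq> C' i" if "i \<in> I" for i
        using BC[of i] that by (auto simp: C'_def)
      show "card (B i - C l) \<le> b" if "i \<in> I" for i
        using Bb[of i] card_mono[of "B i" "B i - C l"] BC[of i] fin[of i] that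
        by (auto dest: finite_subset)
      show "C' i \<inter> C' i' \<subseteq> B i - C l" if "i \<in> I" "i' \<in> I" "i \<noteq> i'" for i i'
        using meet[of i i'] that by (auto simp: C'_def)
      show "small_pieces G s (C' i - (B i - C l))" if "i \<in> I" for i
        by (rule small_pieces_mono[OF pieces[of i]]) (use that in \<open>auto simp: C'_def\<close>)
      show "\<exists>i\<in>I. f \<subseteq> C' i" if f: "f \<in> G" "f \<subseteq> \<Union>(C' ` I)" for f
      proof -
        have "f \<subseteq> \<Union>(C ` insert l I)" "f \<inter> C l = {}"
          using f(2) unfolding U by blast+
        then obtain i where i: "i \<in> insert l I" "f \<subseteq> C i"
          using cover[OF f(1)] by blast
        show ?thesis
        proof (cases "i = l")
          case True
          then have "f = {}" using i \<open>f \<inter> C l = {}\<close> by blast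
          then show ?thesis using leaf.hyps(3) by blast
        next
          case False
          then show ?thesis using i \<open>f \<inter> C l = {}\<close> by (auto simp: C'_def)
        qed
      qed
      \<comment> \<open>Either \<open>v\<close> is in \<open>C l\<close> and loses all its indices,
        or its indices do not change.\<close>
      show "connected_in F {i \<in> I. v \<in> C' i}" for v
        using conn_I[of v] by (cases "v \<in> C l") (simp_all add: C'_def connected_in_def)
    qed
    then obtain X where X: "X \<subseteq> \<Union>(C' ` I)" "card X * s \<le> b * card (\<Union>(C' ` I))"
        "small_pieces G s (\<Union>(C' ` I) - X)"
      by blast
    have finU: "finite (\<Union>(C ` insert l I))"
      using fin \<open>finite I\<close> by blast
    show ?thesis
    proof (intro exI[of _ "X \<union> B l"] conjI)
      show "X \<union> B l \<subseteq> \<Union>(C ` insert l I)"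
        using X(1) U BC[of l] by blast
      \<comment> \<open>The removed vertices of \<open>C l\<close> are counted only once, so the
        recursive bound for \<open>X\<close> and the payment for \<open>B l\<close> by
        \<open>C l\<close> add up.\<close>
      have "card (\<Union>(C ` insert l I)) = card (\<Union>(C' ` I)) + card (C l)"
        using finU fin[of l] unfolding U
        by (subst card_Diff_subset) (auto simp: card_mono le_add_diff_inverse2)
      moreover have "card (X \<union> B l) * s \<le> card X * s + card (B l) * s"
        by (metis add_mult_distrib card_Un_le mult_le_mono1)
      moreover have "card (B l) * s \<le> b * card (C l)"
        using Bb[of l] \<open>s \<le> card (C l)\<close> by (intro mult_le_mono) auto
      ultimately show "card (X \<union> B l) * s \<le> b * card (\<Union>(C ` insert l I))"
        using X(2) by (simp add: distrib_left)
      have "small_pieces G s ((\<Union>(C' ` I) - X) \<union> (C l - B l))"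
      proof (rule small_pieces_Un[OF X(3)])
        show "small_pieces G s (C l - B l)"
          using pieces by simp
        show "(\<Union>(C' ` I) - X) \<inter> (C l - B l) = {}"
          using U by blast
        fix f assume f: "f \<in> G" "f \<subseteq> (\<Union>(C' ` I) - X) \<union> (C l - B l)"
        then have "f \<subseteq> \<Union>(C ` insert l I)"
          using U by blast
        then obtain i where i: "i \<in> insert l I" "f \<subseteq> C i"
          using cover f(1) by blast
        show "f \<subseteq> \<Union>(C' ` I) - X \<or> f \<subseteq> C l - B l"
        proof (cases "i = l")
          case True
          then show ?thesis using i f U by blast
        next
          case False
          then have "C l \<inter> C i \<subseteq> B l"
            using meet[of l i] i by blast
          then show ?thesis using i f by blast
        qed
      qed
      moreover have "\<Union>(C ` insert l I) - (X \<union> B l) = (\<Union>(C' ` I) - X) \<union> (C l - B l)"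
        using U X(1) BC[of l] by blast
      ultimately show "small_pieces G s (\<Union>(C ` insert l I) - (X \<union> B l))"
        by simp
    qed
  qed
qed

text \<open>The start of the merging process: \<open>C\<close> and \<open>B\<close> are both the
  bags of a decomposition, so \<open>C i - B i\<close> is empty. Width \<open>t\<close> means bags
  of at most \<open>t + 1\<close> vertices.\<close>

lemma bounded_treewidth_separator:
  assumes "simple_graph V G" "finite V" "treewidth V G \<le> t"
  obtains X where "X \<subseteq> V" "card X * s \<le> (t + 1) * card V" "small_pieces G s (V - X)"
proof -
  obtain I F B where td: "tree_decomposition V G I F B" and w: "decomposition_width I B \<le> t"
    using treewidth_le_iff[OF assms(1)] assms(3) by blast
  have tree: "is_tree I F" and V: "\<Union>(B ` I) = V" and cover: "\<forall>f\<in>G. \<exists>i\<in>I. f \<subseteq> B i"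
    and conn: "\<forall>v\<in>V. connected_in F {i \<in> I. v \<in> B i}"
    using td by (auto simp: tree_decomposition_def)
  have fin: "finite I"
    using tree by (simp add: is_tree_def)
  have "leaf_ordered F I"
    using tree by (intro acyclic_leaf_ordered) (auto simp: is_tree_def simple_graph_def)
  then have "\<exists>X\<subseteq>\<Union>(B ` I). card X * s \<le> (t + 1) * card (\<Union>(B ` I)) \<and>
      small_pieces G s (\<Union>(B ` I) - X)"
  proof (rule tree_separator)
    show "finite (B i)" if "i \<in> I" for i
      using that V assms(2) by (metis UN_upper finite_subset)
    show "card (B i) \<le> t + 1" if "i \<in> I" for i
    proof -
      have "card (B i) \<le> Max ((\<lambda>i. card (B i)) ` I)"
        using that fin by simp
      then show ?thesis using w unfolding decomposition_width_def by linarith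
    qed
    show "small_pieces G s (B i - B i)" for i
      by (simp add: small_pieces_def)
    show "connected_in F {i \<in> I. v \<in> B i}" for v
    proof (cases "v \<in> V")
      case False
      then have empty: "{i \<in> I. v \<in> B i} = {}" using V by blast
      show ?thesis unfolding empty by (simp add: connected_in_def)
    qed (use conn in blast)
  qed (use cover in auto)
  then show thesis
    using that V by blast
qed

section \<open>Components of hypergraphs\<close>

definition adjacency :: "'a set set \<Rightarrow> ('a \<times> 'a) set" where
  "adjacency E = {(x, y). \<exists>e\<in>E. x \<in> e \<and> y \<in> e}"

definition component :: "'a set set \<Rightarrow> 'a \<Rightarrow> 'a set" where
  "component E v = (adjacency E)\<^sup>* `` {v}"

definition component_edges :: "'a set set \<Rightarrow> 'a \<Rightarrow> 'a set set" where
  "component_edges E v = {e \<in> E. e \<inter> component E v \<noteq> {}}"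

lemma component_eq:
  assumes "e \<in> E" "x \<in> e" "y \<in> e"
  shows "component E x = component E y"
proof -
  have "(x, y) \<in> adjacency E" "(y, x) \<in> adjacency E"
    using assms by (auto simp: adjacency_def)
  then show ?thesis
    unfolding component_def by (auto intro: converse_rtrancl_into_rtrancl)
qed

lemma k_partite_mono: "\<lbrakk>k_partite k n E; E' \<subseteq> E\<rbrakk> \<Longrightarrow> k_partite k n E'"
  unfolding k_partite_def by blast

text \<open>The colourings of different components can be glued, since a hyperedge lies within one
  component. Components are those of the larger \<open>E\<close>, because \<open>E'\<close> arises
  from it by discarding the bad ones.\<close>

lemma k_partite_by_components:
  assumes "k \<ge> 1" and E: "\<And>e. e \<in> E' \<Longrightarrow> e \<in> E"
    and part: "\<And>e v. \<lbrakk>e \<in> E'; v \<in> e\<rbrakk> \<Longrightarrow> k_partite k n (component_edges E v)"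
  shows "k_partite k n E'"
proof -
  let ?proper = "\<lambda>H c. c ` {1..n} \<subseteq> {1..k} \<and> (\<forall>e\<in>H. inj_on c e)"
  define col where "col H = (SOME c. ?proper H c)" for H :: "nat set set"
  have col: "?proper H (col H)" if "k_partite k n H" for H
    using that unfolding k_partite_def col_def by (rule someI_ex)
  \<comment> \<open>The chosen colouring depends only on the set of hyperedges, so all vertices of a
    component share it. Vertices of bad components lie in no hyperedge of \<open>E'\<close>; they
    get the default colour 1, legal by \<open>k \<ge> 1\<close>.\<close>
  define c where "c v = (let H = component_edges E v in if k_partite k n H then col H v else 1)" for v
  have "c ` {1..n} \<subseteq> {1..k}"
  proof
    fix x assume "x \<in> c ` {1..n}"
    then obtain v where v: "v \<in> {1..n}" "x = c v" by blast
    show "x \<in> {1..k}"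
    proof (cases "k_partite k n (component_edges E v)")
      case True
      then have "col (component_edges E v) v \<in> {1..k}"
        using col[OF True] v(1) by blast
      then show ?thesis using v(2) True by (simp add: c_def)
    qed (use v(2) assms(1) in \<open>simp add: c_def\<close>)
  qed
  moreover have "inj_on c e" if e: "e \<in> E'" for e
  proof (cases "e = {}")
    case False
    then obtain x where x: "x \<in> e" by blast
    let ?H = "component_edges E x"
    have "c v = col ?H v" if "v \<in> e" for v
    proof -
      have "component_edges E v = ?H"
        unfolding component_edges_def using component_eq[OF E[OF e] that x] by simp
      then show ?thesis
        using part[OF e x] by (simp add: c_def)
    qed
    moreover have "x \<in> component E x"
      by (simp add: component_def)
    then have "e \<in> ?H"
      using x E[OF e] unfolding component_edges_def by blast
    then have "inj_on (col ?H) e"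
      using col[OF part[OF e x]] by blast
    ultimately show ?thesis
      by (simp add: inj_on_def)
  qed simp
  ultimately show ?thesis
    unfolding k_partite_def by blast
qed

section \<open>The exploration algorithm\<close>

text \<open>Every deterministic algorithm must obey the query bound on arbitrary lists, also on those which
  represent no hypergraph; hence answers that are not sets of \<open>k\<close> vertices are discarded.\<close>

definition valid_answer :: "nat \<Rightarrow> nat \<Rightarrow> nat set option \<Rightarrow> nat set set" where
  "valid_answer k n a = {e. a = Some e \<and> e \<subseteq> {1..n} \<and> card e = k}"

definition valid_answers :: "nat \<Rightarrow> nat \<Rightarrow> incidence_lists \<Rightarrow> (nat \<times> nat) list \<Rightarrow> nat set set" where
  "valid_answers k n A qs = (\<Union>q\<in>set qs. valid_answer k n (A (fst q) (snd q)))"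

primrec ask :: "nat \<Rightarrow> nat \<Rightarrow> (nat \<times> nat) list \<Rightarrow> nat set set \<Rightarrow> (nat set set \<Rightarrow> query_algorithm)
    \<Rightarrow> query_algorithm" where
  "ask k n [] H K = K H"
| "ask k n (q # qs) H K =
     Query (fst q) (snd q) (\<lambda>a. ask k n qs (H \<union> valid_answer k n a) K)"

definition all_queries :: "nat \<Rightarrow> nat set \<Rightarrow> (nat \<times> nat) list" where
  "all_queries d S = List.product (sorted_list_of_set S) [0..<d]"

text \<open>Hyperedges of earlier rounds are not carried along: \<open>S\<close> only grows, so
  every round asks the earlier queries again.\<close>

primrec explore :: "nat \<Rightarrow> nat \<Rightarrow> nat \<Rightarrow> nat \<Rightarrow> nat set \<Rightarrow> nat set set \<Rightarrow> query_algorithm" where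
  "explore k n d 0 S H = Output (k_partite k n H)"
| "explore k n d (Suc r) S H =
     ask k n (all_queries d S) {} (\<lambda>H'. explore k n d r (S \<union> \<Union>H') H')"

section \<open>Query complexity of the exploration\<close>

lemma accepts_ask:
  "accepts A (ask k n qs H K) = accepts A (K (H \<union> valid_answers k n A qs))"
  by (induction qs arbitrary: H) (auto simp: valid_answers_def Un_assoc)

lemma queries_ask:
  "queries A (ask k n qs H K) = qs @ queries A (K (H \<union> valid_answers k n A qs))"
  by (induction qs arbitrary: H) (auto simp: valid_answers_def Un_assoc)

lemma Union_valid_answer: "\<Union>(valid_answer k n a) \<subseteq> {1..n}" "card (\<Union>(valid_answer k n a)) \<le> k"
proof -
  have "valid_answer k n a = {} \<or> (\<exists>e. valid_answer k n a = {e} \<and> e \<subseteq> {1..n} \<and> card e = k)"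
    by (cases a) (auto simp: valid_answer_def)
  then show "\<Union>(valid_answer k n a) \<subseteq> {1..n}" "card (\<Union>(valid_answer k n a)) \<le> k"
    by auto
qed

lemma Union_valid_answers:
  shows "\<Union>(valid_answers k n A qs) \<subseteq> {1..n}"
    and "card (\<Union>(valid_answers k n A qs)) \<le> length qs * k"
proof -
  let ?U = "\<lambda>q. \<Union>(valid_answer k n (A (fst q) (snd q)))"
  have eq: "\<Union>(valid_answers k n A qs) = (\<Union>q\<in>set qs. ?U q)"
    unfolding valid_answers_def by blast
  show "\<Union>(valid_answers k n A qs) \<subseteq> {1..n}"
    unfolding eq using Union_valid_answer(1) by (rule UN_least)
  have "card (\<Union>(valid_answers k n A qs)) \<le> (\<Sum>q\<in>set qs. card (?U q))"
    unfolding eq by (intro card_UN_le) simp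
  also have "\<dots> \<le> card (set qs) * k"
    using sum_bounded_above[of "set qs" "\<lambda>q. card (?U q)" k] Union_valid_answer(2) by simp
  also have "\<dots> \<le> length qs * k"
    by (intro mult_le_mono1 card_length)
  finally show "card (\<Union>(valid_answers k n A qs)) \<le> length qs * k" .
qed

text \<open>At most \<open>m\<close> vertices cost \<open>d\<close> queries each, and each valid
  answer brings at most \<open>k\<close> vertices into the next round.\<close>

primrec explore_bound :: "nat \<Rightarrow> nat \<Rightarrow> nat \<Rightarrow> nat \<Rightarrow> nat" where
  "explore_bound k d 0 m = 0"
| "explore_bound k d (Suc r) m = m * d + explore_bound k d r (m + m * d * k)"

lemma queries_explore:
  assumes "S \<subseteq> {1..n}" "card S \<le> m"
  shows "set (queries A (explore k n d r S H)) \<subseteq> {1..n} \<times> {..<d} \<and>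
    length (queries A (explore k n d r S H)) \<le> explore_bound k d r m"
  using assms
proof (induction r arbitrary: S H m)
  case (Suc r)
  define H' where "H' = valid_answers k n A (all_queries d S)"
  define S' where "S' = S \<union> \<Union>H'"
  have fin: "finite S"
    using Suc.prems finite_subset by blast
  have len: "length (all_queries d S) \<le> m * d"
    using Suc.prems by (simp add: all_queries_def)
  have S': "S' \<subseteq> {1..n}"
    using Suc.prems(1) Union_valid_answers(1) unfolding S'_def H'_def by (meson Un_least)
  have "card (\<Union>H') \<le> m * d * k"
    using Union_valid_answers(2)[of k n A "all_queries d S"] len unfolding H'_def
    by (meson mult_le_mono1 order_trans)
  then have "card S' \<le> m + m * d * k"
    unfolding S'_def using card_Un_le[of S "\<Union>H'"] Suc.prems by linarith
  note IH = Suc.IH[OF S' this, of H']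
  have qs: "queries A (explore k n d (Suc r) S H) = all_queries d S @ queries A (explore k n d r S' H')"
    by (simp add: queries_ask S'_def H'_def)
  have "set (all_queries d S) \<subseteq> {1..n} \<times> {..<d}"
    using fin Suc.prems(1) by (auto simp: all_queries_def)
  then show ?case
    unfolding qs using IH len by auto
qed simp

section \<open>Hyperedges found when the lists represent a hypergraph\<close>

primrec found :: "nat set set \<Rightarrow> nat \<Rightarrow> nat set \<Rightarrow> nat set set \<Rightarrow> nat set set" where
  "found E 0 S H = H"
| "found E (Suc r) S H =
     (let H' = {e \<in> E. e \<inter> S \<noteq> {}} in found E r (S \<union> \<Union>H') H')"

lemma represents_answers:
  assumes "represents d n A E" "i \<in> {1..n}"
  shows "(\<exists>j<d. A i j = Some e) \<longleftrightarrow> e \<in> E \<and> i \<in> e"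
proof -
  obtain es where es: "set es = incident_edges E i"
      "map (A i) [0..<d] = map Some es @ replicate (d - length es) None"
    using assms unfolding represents_def by blast
  have "e \<in> set es \<longleftrightarrow> Some e \<in> set (map Some es @ replicate (d - length es) None)"
    by (simp add: image_iff)
  also have "\<dots> \<longleftrightarrow> Some e \<in> A i ` {..<d}"
    unfolding es(2)[symmetric] by (simp add: atLeast0LessThan)
  also have "\<dots> \<longleftrightarrow> (\<exists>j<d. A i j = Some e)"
    unfolding image_iff by (metis lessThan_iff)
  finally show ?thesis
    using es(1) by (simp add: incident_edges_def)
qed

text \<open>Padding contributes nothing, and by uniformity the filter on answers discards no
  hyperedge of \<open>E\<close>.\<close>

lemma valid_answers_represents:
  assumes "represents d n A E" "uniform_hypergraph k n E" "S \<subseteq> {1..n}"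
  shows "valid_answers k n A (all_queries d S) = {e \<in> E. e \<inter> S \<noteq> {}}"
proof -
  have fin: "finite S"
    using assms finite_subset by blast
  have inc: "(\<exists>j<d. A i j = Some e) \<longleftrightarrow> e \<in> E \<and> i \<in> e" if "i \<in> S" for i e
    using represents_answers[OF assms(1)] that assms(3) by blast
  show ?thesis
  proof (rule set_eqI)
    fix e
    have "e \<in> valid_answers k n A (all_queries d S) \<longleftrightarrow>
        (\<exists>i\<in>S. \<exists>j<d. A i j = Some e) \<and> e \<subseteq> {1..n} \<and> card e = k"
      unfolding valid_answers_def valid_answer_def all_queries_def using fin by fastforce
    also have "\<dots> \<longleftrightarrow> (\<exists>i\<in>S. e \<in> E \<and> i \<in> e)"
      using inc assms(2) unfolding uniform_hypergraph_def by (metis (no_types, lifting))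
    finally show "e \<in> valid_answers k n A (all_queries d S) \<longleftrightarrow> e \<in> {e \<in> E. e \<inter> S \<noteq> {}}"
      by blast
  qed
qed

text \<open>This removes the lists from the analysis: the verdict depends on \<open>E\<close> and
  \<open>S\<close>, not on the order within the lists.\<close>

lemma accepts_explore:
  assumes "represents d n A E" "uniform_hypergraph k n E" "S \<subseteq> {1..n}"
  shows "accepts A (explore k n d r S H) \<longleftrightarrow> k_partite k n (found E r S H)"
  using assms(3)
proof (induction r arbitrary: S H)
  case (Suc r)
  have "S \<union> \<Union>{e \<in> E. e \<inter> S \<noteq> {}} \<subseteq> {1..n}"
    using Suc.prems assms(2) unfolding uniform_hypergraph_def by blast
  from Suc.IH[OF this] show ?case
    by (simp add: accepts_ask valid_answers_represents[OF assms(1,2) Suc.prems] Let_def)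
qed simp

lemma found_subset: "H \<subseteq> E \<Longrightarrow> found E r S H \<subseteq> E"
proof (induction r arbitrary: S H)
  case (Suc r)
  show ?case
    unfolding found.simps Let_def by (rule Suc.IH) blast
qed simp

text \<open>A hyperedge that touches \<open>S\<close> touches the set of every later round;
  membership in \<open>H\<close> settles the case of no rounds.\<close>

lemma found_touching: "\<lbrakk>e \<in> E; e \<inter> S \<noteq> {}; e \<in> H\<rbrakk> \<Longrightarrow> e \<in> found E r S H"
proof (induction r arbitrary: S H)
  case (Suc r)
  show ?case
    unfolding found.simps Let_def by (rule Suc.IH) (use Suc.prems in blast)+
qed simp

text \<open>The first step of the walk stays within a hyperedge touching \<open>S\<close>, so its
  end belongs to the next set. The inequality \<open>i < r\<close> is strict because one more round
  must read the hyperedges at \<open>u\<close>.\<close>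

lemma found_reachable:
  assumes "v \<in> S" "(v, u) \<in> adjacency E ^^ i" "i < r" "e \<in> E" "u \<in> e"
  shows "e \<in> found E r S H"
  using assms(1-3)
proof (induction r arbitrary: S H v i)
  case (Suc r)
  let ?H = "{e \<in> E. e \<inter> S \<noteq> {}}"
  have "e \<in> found E r (S \<union> \<Union>?H) ?H"
  proof (cases i)
    case 0
    then have "u \<in> S" using Suc.prems by simp
    then show ?thesis
      using assms(4,5) by (intro found_touching) blast+
  next
    case (Suc i')
    obtain w where w: "(v, w) \<in> adjacency E" "(w, u) \<in> adjacency E ^^ i'"
      using Suc.prems(2) unfolding Suc by (meson relpow_Suc_D2)
    then have "w \<in> S \<union> \<Union>?H"
      using Suc.prems(1) unfolding adjacency_def by blast
    then show ?thesis
      using Suc.IH[OF _ w(2)] Suc.prems(3) Suc by simp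
  qed
  then show ?case by (simp add: Let_def)
qed simp

lemma relpow_subset_mono:
  fixes R R' :: "('a \<times> 'a) set"
  assumes "R \<subseteq> R'"
  shows "R ^^ i \<subseteq> R' ^^ i"
proof (induction i)
  case (Suc i)
  then show ?case using assms by (simp add: relcomp_mono)
qed simp

text \<open>A walk from \<open>v\<close> never leaves \<open>p\<close>, and a shortest one is no
  longer than the number of adjacent pairs in \<open>p\<close>. The bound \<open>s * s\<close> is
  crude, but any constant will do.\<close>

lemma component_reach_bounded:
  assumes "finite p" "card p \<le> s" "v \<in> p" "u \<in> component E v"
    and closed: "\<And>x y. \<lbrakk>x \<in> p; (x, y) \<in> adjacency E\<rbrakk> \<Longrightarrow> y \<in> p"
  shows "\<exists>i\<le>s * s. (v, u) \<in> adjacency E ^^ i"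
proof -
  let ?R = "adjacency E \<inter> p \<times> p"
  have "(v, u) \<in> (adjacency E)\<^sup>*"
    using assms(4) by (simp add: component_def)
  then have "(v, u) \<in> ?R\<^sup>* \<and> u \<in> p"
  proof (induction rule: rtrancl_induct)
    case (step y z)
    then have "(y, z) \<in> ?R" using closed by blast
    then show ?case using step by (meson IntE mem_Sigma_iff rtrancl.rtrancl_into_rtrancl)
  qed (use assms(3) in simp)
  moreover have "finite ?R"
    using assms(1) by simp
  ultimately obtain i where i: "i \<le> card ?R" "(v, u) \<in> ?R ^^ i"
    using rtrancl_finite_eq_relpow[of ?R] by blast
  have "card ?R \<le> card (p \<times> p)"
    using assms(1) by (intro card_mono) auto
  also have "\<dots> \<le> s * s"
    using assms(2) by (simp add: card_cartesian_product mult_le_mono)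
  finally have "i \<le> s * s" using i(1) by simp
  moreover have "(v, u) \<in> adjacency E ^^ i"
    using i(2) relpow_subset_mono[of ?R "adjacency E" i] by blast
  ultimately show ?thesis by blast
qed

text \<open>The exploration does not know \<open>W\<close> and walks through all of
  \<open>E\<close>. It still sees every hyperedge of the component inside \<open>W\<close>, whose
  vertices all lie in one piece and hence within distance \<open>s * s\<close> of
  \<open>v\<close>.\<close>

lemma component_edges_found:
  assumes pieces: "small_pieces (gaifman_edges E) s W" and "v \<in> W" "v \<in> S"
  shows "component_edges {e \<in> E. e \<subseteq> W} v \<subseteq> found E (Suc (s * s)) S H"
proof
  let ?E = "{e \<in> E. e \<subseteq> W}"
  obtain p where "v \<in> p" "separated_piece (gaifman_edges E) s W p"
    using pieces \<open>v \<in> W\<close> unfolding small_pieces_def by blast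
  then have p: "p \<subseteq> W" "v \<in> p" "finite p" "card p \<le> s"
      "\<And>f. \<lbrakk>f \<in> gaifman_edges E; f \<subseteq> W; f \<inter> p \<noteq> {}\<rbrakk> \<Longrightarrow> f \<subseteq> p"
    unfolding separated_piece_def by auto
  \<comment> \<open>\<open>adjacency\<close> has loops at the vertices of hyperedges, which Gaifman
    edges do not, hence the split on \<open>x = y\<close>.\<close>
  have closed: "y \<in> p" if "x \<in> p" "(x, y) \<in> adjacency ?E" for x y
  proof (cases "x = y")
    case False
    then have "{x, y} \<in> gaifman_edges E" "{x, y} \<subseteq> W"
      using that(2) unfolding adjacency_def gaifman_edges_def by blast+
    then show ?thesis using p(5)[of "{x, y}"] that(1) by simp
  qed (use that in simp)
  fix e assume "e \<in> component_edges ?E v"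
  then have e: "e \<in> E" "e \<inter> component ?E v \<noteq> {}"
    by (simp_all add: component_edges_def)
  then obtain u where u: "u \<in> e" "u \<in> component ?E v"
    by blast
  have "\<exists>i\<le>s * s. (v, u) \<in> adjacency ?E ^^ i"
    by (rule component_reach_bounded[OF p(3,4,2) u(2) closed])
  then obtain i where i: "i \<le> s * s" "(v, u) \<in> adjacency ?E ^^ i"
    by blast
  have "(v, u) \<in> adjacency E ^^ i"
    using relpow_subset_mono[of "adjacency ?E" "adjacency E" i] i(2)
    unfolding adjacency_def by blast
  then show "e \<in> found E (Suc (s * s)) S H"
    using found_reachable[OF \<open>v \<in> S\<close>] i(1) u(1) e(1) by (simp del: found.simps)
qed

section \<open>The tester\<close>

text \<open>Making the input \<open>k\<close>-partite by deleting the hyperedges at \<open>X\<close>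
  and \<open>D\<close> costs at most \<open>d\<close> per vertex. Farness forces \<open>X\<close>
  and \<open>D\<close> to have more than \<open>\<epsilon> * n\<close> vertices together, and the
  choice of \<open>s\<close> leaves at most half of that to \<open>X\<close>.\<close>

lemma far_from_k_partite_bad_vertices:
  assumes "k \<ge> 1" "E \<in> bounded_treewidth_class k d t n" "far_from \<epsilon> k d n (k_partite k n) E"
    and "\<epsilon> > 0" "real s * \<epsilon> \<ge> 2 * (real t + 1)"
  obtains D where "D \<subseteq> {1..n}" "real (card D) \<ge> \<epsilon> / 2 * real n"
    "\<And>S H. S \<inter> D \<noteq> {} \<Longrightarrow> \<not> k_partite k n (found E (Suc (s * s)) S H)"
proof -
  have unif: "uniform_hypergraph k n E" and deg: "max_degree_le d n E"
    and tw: "treewidth {1..n} (gaifman_edges E) \<le> t"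
    using assms(2) by (auto simp: bounded_treewidth_class_def hypergraph_treewidth_def)
  obtain X where X: "X \<subseteq> {1..n}" "card X * s \<le> (t + 1) * card {1..n}"
      "small_pieces (gaifman_edges E) s ({1..n} - X)"
    using bounded_treewidth_separator[OF simple_graph_gaifman[OF unif] finite_atLeastAtMost tw] by blast
  define W where "W = {1..n} - X"
  define E\<^sub>W where "E\<^sub>W = {e \<in> E. e \<subseteq> W}"
  define D where "D = {v \<in> W. \<not> k_partite k n (component_edges E\<^sub>W v)}"
  define E' where "E' = {e \<in> E\<^sub>W. e \<inter> D = {}}"
  have "k_partite k n E'"
    using assms(1)
  proof (rule k_partite_by_components[where E = E\<^sub>W])
    show "k_partite k n (component_edges E\<^sub>W v)" if "e \<in> E'" "v \<in> e" for e v
      using that unfolding E'_def E\<^sub>W_def D_def by blast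
  qed (simp add: E'_def)
  moreover have "uniform_hypergraph k n E'"
    using unif by (auto simp: uniform_hypergraph_def E'_def E\<^sub>W_def)
  ultimately have far: "hypergraph_dist d n E E' > \<epsilon>"
    using assms(3) unfolding far_from_def by blast
  have "E' - E = {}"
    by (auto simp: E'_def E\<^sub>W_def)
  then have far': "real (card (E - E')) / (real d * real n) > \<epsilon>"
    using far unfolding hypergraph_dist_def \<open>E' - E = {}\<close> by simp
  \<comment> \<open>Otherwise division by zero would make the distance 0, which does not exceed
    \<open>\<epsilon>\<close>.\<close>
  have dn: "real d * real n > 0"
    using far' assms(4) by (cases "real d * real n = 0") auto
  have XD: "X \<union> D \<subseteq> {1..n}"
    using X(1) by (auto simp: D_def W_def)
  have finE: "finite E"
    using unif unfolding uniform_hypergraph_def by (intro finite_subset[of E "Pow {1..n}"]) auto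
  \<comment> \<open>A deleted hyperedge either is not contained in \<open>W\<close>, and then meets
    \<open>X\<close>, or meets \<open>D\<close>.\<close>
  have "E - E' \<subseteq> (\<Union>v\<in>X \<union> D. incident_edges E v)"
  proof
    fix e assume e: "e \<in> E - E'"
    then have "e \<subseteq> {1..n}"
      using unif by (auto simp: uniform_hypergraph_def)
    then show "e \<in> (\<Union>v\<in>X \<union> D. incident_edges E v)"
      using e unfolding E'_def E\<^sub>W_def W_def incident_edges_def by blast
  qed
  then have "card (E - E') \<le> card (\<Union>v\<in>X \<union> D. incident_edges E v)"
    using finE XD by (intro card_mono)
      (auto simp: incident_edges_def intro: finite_subset[OF XD] finite_subset)
  also have "\<dots> \<le> (\<Sum>v\<in>X \<union> D. card (incident_edges E v))"
    using finite_subset[OF XD] by (intro card_UN_le) simp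
  also have "\<dots> \<le> card (X \<union> D) * d"
    using sum_bounded_above[of "X \<union> D" "\<lambda>v. card (incident_edges E v)" d] deg XD
    by (auto simp: max_degree_le_def)
  also have "\<dots> \<le> (card X + card D) * d"
    by (simp add: card_Un_le)
  finally have "real (card (E - E')) \<le> (real (card X) + real (card D)) * real d"
    by (metis of_nat_add of_nat_le_iff of_nat_mult)
  moreover have "\<epsilon> * (real d * real n) < real (card (E - E'))"
    using far' dn by (simp add: field_simps)
  ultimately have "(\<epsilon> * real n) * real d < (real (card X) + real (card D)) * real d"
    by (simp add: algebra_simps)
  then have many: "\<epsilon> * real n < real (card X) + real (card D)"
    by (simp add: mult_less_cancel_right)
  have "real (card X) \<le> \<epsilon> / 2 * real n"
  proof -
    have "card X * s \<le> (t + 1) * n"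
      using X(2) by simp
    then have "real (card X * s) \<le> real ((t + 1) * n)"
      by (rule of_nat_mono)
    then have "real (card X) * real s \<le> (real t + 1) * real n"
      by (simp add: algebra_simps)
    also have "\<dots> \<le> (real s * \<epsilon> / 2) * real n"
      using assms(5) by (intro mult_right_mono) auto
    finally have "real (card X) * real s \<le> (\<epsilon> / 2 * real n) * real s"
      by (simp add: algebra_simps)
    moreover have "real s > 0"
      using assms(4,5) by (cases "s = 0") auto
    ultimately show ?thesis by simp
  qed
  then have "real (card D) \<ge> \<epsilon> / 2 * real n"
    using many by simp
  moreover have "\<not> k_partite k n (found E (Suc (s * s)) S H)" if "S \<inter> D \<noteq> {}" for S H
  proof
    assume part: "k_partite k n (found E (Suc (s * s)) S H)"
    obtain v where v: "v \<in> S" "v \<in> D"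
      using \<open>S \<inter> D \<noteq> {}\<close> by blast
    then have "component_edges E\<^sub>W v \<subseteq> found E (Suc (s * s)) S H"
      unfolding E\<^sub>W_def using X(3) by (intro component_edges_found) (auto simp: D_def W_def)
    then show False
      using k_partite_mono[OF part] v(2) unfolding D_def by blast
  qed
  ultimately show thesis
    using that XD by blast
qed

section \<open>Sampling and error probability\<close>

definition samples :: "nat \<Rightarrow> nat \<Rightarrow> nat list set" where
  "samples n m = {xs. set xs \<subseteq> {1..n} \<and> length xs = m}"

text \<open>Samples are lists with repetitions, so their entries are independent and uniform. For
  \<open>n = 0\<close> and \<open>m > 0\<close> there is no sample, while \<open>pmf_of_set\<close>
  needs a nonempty set.\<close>

definition partiteness_tester :: "nat \<Rightarrow> nat \<Rightarrow> nat \<Rightarrow> nat \<Rightarrow> nat \<Rightarrow> query_algorithm pmf" where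
  "partiteness_tester k d r m n =
     (if n = 0 then return_pmf (Output True)
      else map_pmf (\<lambda>xs. explore k n d r (set xs) {}) (pmf_of_set (samples n m)))"

lemma finite_samples: "finite (samples n m)"
  unfolding samples_def using finite_lists_length_eq[of "{1..n}" m] by simp

lemma samples_nonempty: "n > 0 \<Longrightarrow> samples n m \<noteq> {}"
  unfolding samples_def by (auto intro!: exI[of _ "replicate m 1"])

lemma query_bounded_partiteness_tester:
  "query_bounded d n (explore_bound k d r m) (partiteness_tester k d r m n)"
proof (cases "n = 0")
  case True
  then show ?thesis by (simp add: query_bounded_def partiteness_tester_def)
next
  case False
  then have set_M: "set_pmf (partiteness_tester k d r m n) =
      (\<lambda>xs. explore k n d r (set xs) {}) ` samples n m"
    by (simp add: partiteness_tester_def finite_samples samples_nonempty)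
  have xs: "set xs \<subseteq> {1..n}" "card (set xs) \<le> m" if "xs \<in> samples n m" for xs
    using that card_length[of xs] unfolding samples_def by auto
  show ?thesis
    unfolding query_bounded_def set_M using queries_explore[OF xs] by blast
qed

lemma accept_prob_partiteness_tester:
  assumes "n > 0" "represents d n A E" "uniform_hypergraph k n E"
  shows "accept_prob (partiteness_tester k d r m n) A =
    real (card {xs \<in> samples n m. k_partite k n (found E r (set xs) {})}) / real n ^ m"
proof -
  have "card (samples n m) = n ^ m"
    using card_lists_length_eq[of "{1..n}" m] by (simp add: samples_def)
  moreover have "samples n m \<inter> {xs. accepts A (explore k n d r (set xs) {})} =
      {xs \<in> samples n m. k_partite k n (found E r (set xs) {})}"
    using accepts_explore[OF assms(2,3)] by (auto simp: samples_def)
  ultimately show ?thesis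
    using assms(1)
    by (simp add: accept_prob_def partiteness_tester_def vimage_def measure_pmf_of_set
        finite_samples samples_nonempty)
qed

text \<open>The error is one-sided: subhypergraphs of a \<open>k\<close>-partite hypergraph are
  \<open>k\<close>-partite, so such inputs are always accepted. On far inputs, \<open>m\<close>
  independent vertices all miss \<open>D\<close> with probability at most
  \<open>(1 - \<epsilon> / 2) ^ m\<close>.\<close>

lemma is_tester_partiteness_tester:
  assumes "k \<ge> 1" "0 < \<epsilon>" "\<epsilon> < 1" "real s * \<epsilon> \<ge> 2 * (real t + 1)" "(1 - \<epsilon> / 2) ^ m \<le> 1 / 3"
  shows "is_tester \<epsilon> k d n (bounded_treewidth_class k d t n) (k_partite k n)
    (partiteness_tester k d (Suc (s * s)) m n)"
proof (cases "n = 0")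
  case True
  \<comment> \<open>The empty hypergraph is \<open>k\<close>-partite and, for \<open>n = 0\<close>,
    has distance 0 from every input, so no input is far.\<close>
  then have "\<not> far_from \<epsilon> k d n (k_partite k n) E" if "uniform_hypergraph k n E" for E
    using that assms(1,2)
    by (auto simp: far_from_def hypergraph_dist_def uniform_hypergraph_def k_partite_def
        intro!: exI[of _ "{}"])
  then show ?thesis
    using True by (auto simp: is_tester_def bounded_treewidth_class_def partiteness_tester_def
        accept_prob_def)
next
  case False
  let ?M = "partiteness_tester k d (Suc (s * s)) m n"
  have "accept_prob ?M A \<ge> 2 / 3"
    if "E \<in> bounded_treewidth_class k d t n" "represents d n A E" "k_partite k n E" for E A
  proof -
    have "uniform_hypergraph k n E"
      using that(1) by (simp add: bounded_treewidth_class_def)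
    moreover have "k_partite k n (found E r S {})" for r S
      using k_partite_mono[OF that(3) found_subset] by blast
    moreover have "card (samples n m) = n ^ m"
      using card_lists_length_eq[of "{1..n}" m] by (simp add: samples_def)
    ultimately show ?thesis
      using accept_prob_partiteness_tester[of n d A E k "Suc (s * s)" m] that(2) False
      by (simp del: found.simps)
  qed
  moreover have "accept_prob ?M A \<le> 1 / 3"
    if E: "E \<in> bounded_treewidth_class k d t n" "represents d n A E"
      and far: "far_from \<epsilon> k d n (k_partite k n) E" for E A
  proof -
    obtain D where D: "D \<subseteq> {1..n}" "real (card D) \<ge> \<epsilon> / 2 * real n"
        "\<And>S H. S \<inter> D \<noteq> {} \<Longrightarrow> \<not> k_partite k n (found E (Suc (s * s)) S H)"
      using far_from_k_partite_bad_vertices[OF assms(1) E(1) far assms(2,4)] by blast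
    let ?acc = "{xs \<in> samples n m. k_partite k n (found E (Suc (s * s)) (set xs) {})}"
    have "?acc \<subseteq> {xs. set xs \<subseteq> {1..n} - D \<and> length xs = m}"
      using D(3) unfolding samples_def by blast
    then have "card ?acc \<le> card {xs. set xs \<subseteq> {1..n} - D \<and> length xs = m}"
      by (intro card_mono finite_lists_length_eq) auto
    also have "\<dots> = card ({1..n} - D) ^ m"
      by (intro card_lists_length_eq) auto
    finally have "real (card ?acc) \<le> real (card ({1..n} - D)) ^ m"
      by (metis of_nat_le_iff of_nat_power)
    also have "real (card ({1..n} - D)) = real n - real (card D)"
      using D(1) card_mono[OF _ D(1)] by (simp add: card_Diff_subset finite_subset of_nat_diff)
    \<comment> \<open>Monotonicity of powers needs a nonnegative base, that is,
      \<open>card D \<le> n\<close>.\<close>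
    also have "(real n - real (card D)) ^ m \<le> ((1 - \<epsilon> / 2) * real n) ^ m"
      using D(2) card_mono[OF _ D(1)] by (intro power_mono) (auto simp: algebra_simps)
    also have "\<dots> \<le> 1 / 3 * real n ^ m"
      unfolding power_mult_distrib by (intro mult_right_mono assms(5)) simp
    finally have "real (card ?acc) / real n ^ m \<le> 1 / 3"
      using False by (simp add: field_simps)
    moreover have "uniform_hypergraph k n E"
      using E(1) by (simp add: bounded_treewidth_class_def)
    ultimately show ?thesis
      using accept_prob_partiteness_tester[of n d A E k "Suc (s * s)" m] E(2) False
      by (simp del: found.simps)
  qed
  ultimately show ?thesis
    unfolding is_tester_def by blast
qed

theorem theorem3:
  fixes k d t :: nat
  assumes "k \<ge> 3"
  shows "strongly_testable k d (bounded_treewidth_class k d t) (k_partite k)"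
  unfolding strongly_testable_def
proof (intro allI impI)
  fix \<epsilon> :: real
  assume \<epsilon>: "0 < \<epsilon> \<and> \<epsilon> < 1"
  obtain s :: nat where "2 * (real t + 1) / \<epsilon> \<le> real s"
    using real_arch_simple by blast
  then have s: "real s * \<epsilon> \<ge> 2 * (real t + 1)"
    using \<epsilon> by (simp add: field_simps)
  obtain m where "(1 - \<epsilon> / 2) ^ m < 1 / 3"
    using real_arch_pow_inv[of "1 / 3" "1 - \<epsilon> / 2"] \<epsilon> by auto
  then have "is_tester \<epsilon> k d n (bounded_treewidth_class k d t n) (k_partite k n)
      (partiteness_tester k d (Suc (s * s)) m n)" for n
    using assms s \<epsilon> by (intro is_tester_partiteness_tester) auto
  \<comment> \<open>Both \<open>s\<close> and \<open>m\<close> were chosen from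
    \<open>\<epsilon>\<close> and \<open>t\<close> alone, so
    \<open>explore_bound k d (Suc (s * s)) m\<close> is a query bound independent of
    \<open>n\<close>.\<close>
  then show "\<exists>q M. \<forall>n. is_tester \<epsilon> k d n (bounded_treewidth_class k d t n) (k_partite k n) (M n) \<and>
      query_bounded d n q (M n)"
    using query_bounded_partiteness_tester by blast
qed

end
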